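(* Let $\mathbb{K}$ be an algebraically closed field of characteristic zero, let $n\ge 1$, and let $A$ be a commutative associative unital local $\mathbb{K}$-algebra with $\dim_{\mathbb{K}} A=n+1$ and maximal ideal $\mathfrak{m}$. Fix a basis $s_1,\ldots,s_n$ of $\mathfrak{m}$, and let $f_1,\ldots,f_n\in\mathbb{K}[x_1,\ldots,x_n]$ be the corresponding basic polynomials of $A$. Then the additive action $*$ on $\mathbb{P}^n$ corresponding to $A$ is conjugate to the standard additive action $\circ$ on $\mathbb{P}^n$ by the automorphism $\varphi$ given by the basic polynomials of $A$. That is, let $U=\{[z_0:\ldots:z_n]\in\mathbb{P}^n : z_0\neq 0\}\cong\mathbb{A}^n$ and let $\varphi\in\mathrm{Aut}(U)$ be the automorphism $$\varphi([1:x_1:\ldots:x_n])=[1:f_1(x_1,\ldots,x_n):\ldots:f_n(x_1,\ldots,x_n)].$$ Then $$\varphi(y\circ p)=y*\varphi(p)\qquad\text{for all } y\in\mathbb{G}_a^n,\ p\in U.$$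
   Context: $\mathbb{G}_a=(\mathbb{K},+)$ denotes the additive group of $\mathbb{K}$. An additive action on an irreducible algebraic variety $X$ is an effective regular action $\mathbb{G}_a^n\times X\to X$ with an open orbit. Let $A$ be a commutative associative unital local $\mathbb{K}$-algebra with $\dim A=n+1$ and maximal ideal $\mathfrak{m}$, and fix a basis $s_1,\ldots,s_n$ of $\mathfrak{m}$, so that $1,s_1,\ldots,s_n$ is a basis of $A$. Elements of $\mathfrak{m}$ are nilpotent, so $\exp(a)=\sum_{k\ge 0}a^k/k!$ is defined for $a\in\mathfrak{m}$. Additive action corresponding to $A$ (Hassett–Tschinkel correspondence): identify $\mathbb{P}^n$ with $\mathbb{P}(A)$ by letting $[z_0:z_1:\ldots:z_n]$ correspond to the class of $z_0+z_1s_1+\ldots+z_ns_n$. An element $y=(y_1,\ldots,y_n)\in\mathbb{G}_a^n$ acts on $\mathbb{P}(A)$ by multiplication by $\exp(y_1s_1+\ldots+y_ns_n)$; this action is denoted $p\mapsto y*p$. Standard additive action on $\mathbb{P}^n$: $y\circ[z_0:z_1:\ldots:z_n]=[z_0:z_1+y_1z_0:\ldots:z_n+y_nz_0]$. Basic polynomials of $A$ (with respect to the basis $s_1,\ldots,s_n$): the polynomials $f_1,\ldots,f_n\in\mathbb{K}[x_1,\ldots,x_n]$ defined by $$\exp(x_1s_1+\ldots+x_ns_n)=1+f_1(x)s_1+\ldots+f_n(x)s_n$$ (computed in $A\otimes_{\mathbb{K}}\mathbb{K}[x_1,\ldots,x_n]$). The assignment $x_1\mapsto f_1,\ldots,x_n\mapsto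 f_n$ is an automorphism of the algebra $\mathbb{K}[x_1,\ldots,x_n]$. The affine chart $U=\{z_0\ne 0\}$, identified with $1+\mathfrak{m}\subset A$, is the open orbit of both actions. Its automorphism group $\mathrm{Aut}(U)\cong\mathrm{Aut}(\mathbb{A}^n)$ is the affine Cremona group. *)

theory Defs
  imports "HOL-Analysis.Cartesian_Space" "HOL-Computational_Algebra.Polynomial" "HOL-Library.Poly_Mapping"
begin

section \<open>Local algebras over a field\<close>

locale algebra_over = vector_space smul
  for smul :: "'k::field \<Rightarrow> 'a::comm_ring_1 \<Rightarrow> 'a" +
  assumes smul_mult: "smul c (a * b) = smul c a * b"

text \<open>The ideals of a commutative ring are its submodules over itself.\<close>

definition ring_ideal :: "'a::comm_ring_1 set \<Rightarrow> bool"
  where "ring_ideal I \<longleftrightarrow> module.subspace (*) I"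

definition maximal_ideal :: "'a::comm_ring_1 set \<Rightarrow> bool"
  where "maximal_ideal M \<longleftrightarrow>
    ring_ideal M \<and> M \<noteq> UNIV \<and> (\<forall>J. ring_ideal J \<and> M \<subseteq> J \<longrightarrow> J = M \<or> J = UNIV)"

definition local_ring_with :: "'a::comm_ring_1 set \<Rightarrow> bool"
  where "local_ring_with M \<longleftrightarrow> {I. maximal_ideal I} = {M}"

definition indexed_basis :: "('k::field \<Rightarrow> 'a::ab_group_add \<Rightarrow> 'a) \<Rightarrow> ('n \<Rightarrow> 'a) \<Rightarrow> 'a set \<Rightarrow> bool"
  where "indexed_basis smul s V \<longleftrightarrow>
    inj s \<and> \<not> module.dependent smul (range s) \<and> module.span smul (range s) = V"

text \<open>
  \<open>Sum_any\<close> adds up the nonzero terms, so this is the series of \<open>exp a\<close> whenever \<open>a\<close> is nilpotent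
  (it is not meaningful otherwise).
\<close>

definition nilpotent_exp :: "('k::field_char_0 \<Rightarrow> 'a::comm_ring_1 \<Rightarrow> 'a) \<Rightarrow> 'a \<Rightarrow> 'a"
  where "nilpotent_exp smul a = Sum_any (\<lambda>k. smul (inverse (fact k)) (a ^ k))"


section \<open>Polynomials in variables indexed by a finite type\<close>

text \<open>
  A monomial is a finitely supported exponent vector, a polynomial a finitely supported
  coefficient function on monomials.  The ring structure on \<open>('a, 'n) mpoly\<close> is the convolution
  product of \<open>Poly_Mapping\<close>, for an arbitrary commutative coefficient ring \<open>'a\<close>.
\<close>

type_synonym ('a, 'n) mpoly = "('n \<Rightarrow>\<^sub>0 nat) \<Rightarrow>\<^sub>0 'a"

definition mpoly_eval :: "('k::comm_ring_1, 'n::finite) mpoly \<Rightarrow> 'k ^ 'n \<Rightarrow> 'k"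
  where "mpoly_eval p x =
    (\<Sum>m \<in> Poly_Mapping.keys p. Poly_Mapping.lookup p m * (\<Prod>i\<in>UNIV. (x $ i) ^ Poly_Mapping.lookup m i))"

definition poly_map :: "('n::finite \<Rightarrow> ('k::comm_ring_1, 'n) mpoly) \<Rightarrow> 'k ^ 'n \<Rightarrow> 'k ^ 'n"
  where "poly_map f x = (\<chi> i. mpoly_eval (f i) x)"

text \<open>
  For a \<open>'k\<close>-algebra \<open>'a\<close>, the tensor product of \<open>'a\<close> with the polynomial ring over \<open>'k\<close> is
  \<open>('a, 'n) mpoly\<close>: \<open>tensor smul a p\<close> is the pure tensor of \<open>a\<close> and \<open>p\<close>, with coefficients
  \<open>p\<^sub>m a\<close>, and \<open>mpoly_scale\<close> is the coefficientwise scalar multiplication.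
\<close>

definition tensor ::
  "('k::zero \<Rightarrow> 'a::zero \<Rightarrow> 'a) \<Rightarrow> 'a \<Rightarrow> ('k, 'n) mpoly \<Rightarrow> ('a, 'n) mpoly"
  where "tensor smul a p = Poly_Mapping.map (\<lambda>c. smul c a) p"

definition mpoly_scale ::
  "('k \<Rightarrow> 'a::zero \<Rightarrow> 'a) \<Rightarrow> 'k \<Rightarrow> ('a, 'n) mpoly \<Rightarrow> ('a, 'n) mpoly"
  where "mpoly_scale smul c p = Poly_Mapping.map (smul c) p"

definition mpoly_var :: "'n \<Rightarrow> ('k::zero_neq_one, 'n) mpoly"
  where "mpoly_var i = Poly_Mapping.single (Poly_Mapping.single i 1) 1"

text \<open>The identity \<open>exp (\<Sum>\<^sub>i x\<^sub>i s\<^sub>i) = 1 + \<Sum>\<^sub>i f\<^sub>i(x) s\<^sub>i\<close> in the tensor product.\<close>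

definition is_basic_polys ::
  "('k::field_char_0 \<Rightarrow> 'a::comm_ring_1 \<Rightarrow> 'a) \<Rightarrow> ('n::finite \<Rightarrow> 'a) \<Rightarrow> ('n \<Rightarrow> ('k, 'n) mpoly) \<Rightarrow> bool"
  where "is_basic_polys smul s f \<longleftrightarrow>
    nilpotent_exp (mpoly_scale smul) (\<Sum>i\<in>UNIV. tensor smul (s i) (mpoly_var i)) =
      1 + (\<Sum>i\<in>UNIV. tensor smul (s i) (f i))"

text \<open>For a basis \<open>s\<close> of the maximal ideal, such a family exists and is unique.\<close>

definition basic_polys ::
  "('k::field_char_0 \<Rightarrow> 'a::comm_ring_1 \<Rightarrow> 'a) \<Rightarrow> ('n::finite \<Rightarrow> 'a) \<Rightarrow> 'n \<Rightarrow> ('k, 'n) mpoly"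
  where "basic_polys smul s = (THE f. is_basic_polys smul s f)"


section \<open>Projective space and the chart of points with nonzero zeroth coordinate\<close>

text \<open>
  The class of a nonzero vector \<open>v\<close> in the projective space of a vector space is the set of its
  nonzero multiples.  The homogeneous coordinates \<open>z\<^sub>0, \<dots>, z\<^sub>n\<close> of n-dimensional projective space
  are indexed by \<open>'n option\<close>, where \<open>None\<close> plays the role of the index 0.
\<close>

definition proj_class :: "('k::zero \<Rightarrow> 'v \<Rightarrow> 'v) \<Rightarrow> 'v \<Rightarrow> 'v set"
  where "proj_class smul v = {smul c v | c. c \<noteq> 0}"

definition proj_pt :: "'k::field ^ ('n::finite option) \<Rightarrow> ('k ^ ('n option)) set"
  where "proj_pt z = proj_class (*s) z"

definition chart_U :: "('k::field ^ ('n::finite option)) set set"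
  where "chart_U = {proj_pt z | z. z $ None \<noteq> 0}"

definition affine_pt :: "'k::field ^ 'n::finite \<Rightarrow> ('k ^ ('n option)) set"
  where "affine_pt x = proj_pt (\<chi> j. case j of None \<Rightarrow> 1 | Some i \<Rightarrow> x $ i)"

lemma mem_affine_pt:
  "z \<in> affine_pt x \<longleftrightarrow> z $ None \<noteq> 0 \<and> (\<forall>i. z $ Some i = z $ None * x $ i)"
proof -
  have all_opt: "(\<forall>j::'b option. P j) \<longleftrightarrow> P None \<and> (\<forall>i. P (Some i))" for P
    by (metis option.exhaust)
  show ?thesis
    by (auto simp: affine_pt_def proj_pt_def proj_class_def vec_eq_iff all_opt)
qed

lemma inj_affine_pt: "inj affine_pt"
proof (rule injI)
  fix x y :: "'a ^ 'b"
  assume eq: "affine_pt x = affine_pt y"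
  let ?z = "(\<chi> j. case j of None \<Rightarrow> 1 | Some i \<Rightarrow> x $ i) :: 'a ^ ('b option)"
  have "?z \<in> affine_pt x" by (simp add: mem_affine_pt)
  then have "?z \<in> affine_pt y" using eq by simp
  then show "x = y" by (simp add: mem_affine_pt vec_eq_iff)
qed

lemma proj_pt_eq_affine_pt:
  assumes "z $ None \<noteq> 0"
  shows "proj_pt z = affine_pt (\<chi> i. z $ Some i / z $ None)"
proof -
  have all_opt: "(\<forall>j::'b option. P j) \<longleftrightarrow> P None \<and> (\<forall>i. P (Some i))" for P
    by (metis option.exhaust)
  have "w \<in> proj_pt z \<longleftrightarrow> w \<in> affine_pt (\<chi> i. z $ Some i / z $ None)" for w
  proof
    assume "w \<in> proj_pt z"
    then show "w \<in> affine_pt (\<chi> i. z $ Some i / z $ None)"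
      using assms by (auto simp: mem_affine_pt proj_pt_def proj_class_def)
  next
    assume "w \<in> affine_pt (\<chi> i. z $ Some i / z $ None)"
    then have "w = (w $ None / z $ None) *s z" "w $ None / z $ None \<noteq> 0"
      using assms by (auto simp: mem_affine_pt vec_eq_iff all_opt)
    then show "w \<in> proj_pt z" by (auto simp: proj_pt_def proj_class_def)
  qed
  then show ?thesis by blast
qed

lemma chart_U_eq_range: "chart_U = range affine_pt"
  by (auto simp: chart_U_def image_iff proj_pt_eq_affine_pt)
     (auto simp: affine_pt_def intro!: exI[of _ "\<chi> j. case j of None \<Rightarrow> 1 | Some i \<Rightarrow> _ i"])

text \<open>
  Self-maps of \<open>chart_U\<close> given by polynomials in the affine coordinates; \<open>affine_pt\<close> is injective
  with range \<open>chart_U\<close>, so \<open>inv affine_pt\<close> reads off these coordinates.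
\<close>

definition chart_map ::
  "('n::finite \<Rightarrow> ('k::field, 'n) mpoly) \<Rightarrow> ('k ^ ('n option)) set \<Rightarrow> ('k ^ ('n option)) set"
  where "chart_map f p = affine_pt (poly_map f (inv affine_pt p))"

lemma chart_map_affine_pt: "chart_map f (affine_pt x) = affine_pt (\<chi> i. mpoly_eval (f i) x)"
  by (simp add: chart_map_def poly_map_def inj_affine_pt)

definition regular_on_U :: "(('k::field ^ ('n::finite option)) set \<Rightarrow> ('k ^ ('n option)) set) \<Rightarrow> bool"
  where "regular_on_U g \<longleftrightarrow> (\<exists>f. \<forall>p\<in>chart_U. g p = chart_map f p)"

definition Aut_U :: "(('k::field ^ ('n::finite option)) set \<Rightarrow> ('k ^ ('n option)) set) set"
  where "Aut_U = {g. bij_betw g chart_U chart_U \<and>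
    regular_on_U g \<and> regular_on_U (inv_into chart_U g)}"


section \<open>Two additive actions on projective space\<close>

text \<open>
  Both actions are induced by linear automorphisms of the underlying vector space, applied to the
  set of representatives of a point.
\<close>

definition standard_action ::
  "'k::field ^ 'n::finite \<Rightarrow> ('k ^ ('n option)) set \<Rightarrow> ('k ^ ('n option)) set"
  where "standard_action y p =
    (\<lambda>z. \<chi> j. case j of None \<Rightarrow> z $ None | Some i \<Rightarrow> z $ Some i + y $ i * z $ None) ` p"

definition alg_elem :: "('k::field \<Rightarrow> 'a::comm_ring_1 \<Rightarrow> 'a) \<Rightarrow> ('n::finite \<Rightarrow> 'a) \<Rightarrow> 'k ^ ('n option) \<Rightarrow> 'a"
  where "alg_elem smul s z = smul (z $ None) 1 + (\<Sum>i\<in>UNIV. smul (z $ Some i) (s i))"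

text \<open>
  The point \<open>p\<close> is carried to the projective space of the algebra by \<open>alg_elem\<close> (a linear
  isomorphism when \<open>1, s\<^sub>1, \<dots>, s\<^sub>n\<close> is a basis), multiplied there by \<open>exp (\<Sum>\<^sub>i y\<^sub>i s\<^sub>i)\<close>, and carried
  back.
\<close>

definition algebra_action ::
  "('k::field_char_0 \<Rightarrow> 'a::comm_ring_1 \<Rightarrow> 'a) \<Rightarrow> ('n::finite \<Rightarrow> 'a) \<Rightarrow> 'k ^ 'n
    \<Rightarrow> ('k ^ ('n option)) set \<Rightarrow> ('k ^ ('n option)) set"
  where "algebra_action smul s y p =
    alg_elem smul s -`
      ((*) (nilpotent_exp smul (\<Sum>i\<in>UNIV. smul (y $ i) (s i))) ` alg_elem smul s ` p)"

end

theory Submission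
  imports Defs "HOL-Computational_Algebra.Formal_Power_Series"
begin

text \<open>
  On the chart, a point is an element \<open>1 + u\<close> of \<open>1 + \<mm>\<close> up to scalars.  Its affine coordinates
  are those of \<open>u\<close> in the basis \<open>s\<close>, and in them the map given by the basic polynomials is
  \<open>a \<mapsto> exp a\<close> from \<open>\<mm>\<close> to \<open>1 + \<mm>\<close>.  The standard action is translation on \<open>\<mm>\<close>, the action
  of the algebra is multiplication by \<open>exp b\<close>, so the conjugation is the functional equation
  \<open>exp (a + b) = exp b exp a\<close>, valid for nilpotent elements (\<open>nilpotent_exp_add\<close>).

  The map is an automorphism of the chart because the logarithm inverts it, and the logarithm
  is again given by polynomials.  To treat both series alike, a formal power series \<open>F\<close> over the
  field is evaluated at a nilpotent element of an arbitrary algebra (\<open>fps_eval\<close>).  Evaluation is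
  compatible with composition of series, so \<open>exp\<close> and \<open>log\<close> are inverse on \<open>\<mm>\<close> because
  \<open>exp X - 1\<close> and its compositional inverse are so as formal series.

  Where polynomials come in: the generic element \<open>\<Sum>\<^sub>i x\<^sub>i s\<^sub>i\<close> of \<open>A[x\<^sub>1, \<dots>, x\<^sub>n]\<close> is nilpotent, and
  if \<open>F\<close> has no constant term then the value of \<open>F\<close> there has all its coefficients in \<open>\<mm>\<close>.
  Expanding them in the basis \<open>s\<close> gives polynomials \<open>f\<^sub>1, \<dots>, f\<^sub>n\<close> (\<open>fps_eval_generic_elem\<close>).
  Substituting a point for the variables is a homomorphism to \<open>A\<close> and commutes with \<open>F\<close>, so
  these polynomials compute \<open>F\<close> on \<open>\<mm>\<close> in coordinates (\<open>fps_eval_lin\<close>).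

  All of this rests on the maximal ideal consisting of nilpotent elements, which is proved
  from finite dimension (\<open>nilpotent_if_in_local\<close>).
\<close>

section \<open>Power series at nilpotent elements\<close>

text \<open>
  \<open>Sum_any\<close> adds up the nonzero terms, so the definition requires no bound on the order of
  nilpotency; the value is meaningful when the terms vanish from some exponent on.
\<close>

definition fps_eval :: "('k::field \<Rightarrow> 'a::comm_ring_1 \<Rightarrow> 'a) \<Rightarrow> 'k fps \<Rightarrow> 'a \<Rightarrow> 'a"
  where "fps_eval smul F a = Sum_any (\<lambda>k. smul (fps_nth F k) (a ^ k))"

lemma nilpotent_exp_eq_fps_eval: "nilpotent_exp smul a = fps_eval smul (fps_exp 1) a"
  by (simp add: nilpotent_exp_def fps_eval_def field_simps)

lemma power_eq_0_mono:
  fixes a :: "'a::comm_ring_1"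
  assumes "a ^ m = 0" "m \<le> n"
  shows "a ^ n = 0"
  using assms by (metis le_add_diff_inverse mult_zero_left power_add)

lemma power_add_eq_0:
  fixes a b :: "'a::comm_ring_1"
  assumes "a ^ m = 0" "b ^ n = 0"
  shows "(a + b) ^ (m + n) = 0"
proof -
  have "of_nat (m + n choose k) * a ^ k * b ^ (m + n - k) = 0" if "k \<le> m + n" for k
  proof (cases "m \<le> k")
    case True
    then show ?thesis using power_eq_0_mono[OF assms(1)] by simp
  next
    case False
    then have "n \<le> m + n - k" by simp
    then show ?thesis using power_eq_0_mono[OF assms(2)] by simp
  qed
  then show ?thesis by (simp add: binomial_ring)
qed

lemma sum_nilpotent:
  fixes g :: "'i \<Rightarrow> 'a::comm_ring_1"
  assumes "\<And>i. i \<in> I \<Longrightarrow> \<exists>N. g i ^ N = 0"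
  shows "\<exists>N. sum g I ^ N = 0"
  using assms
proof (induction I rule: infinite_finite_induct)
  case (insert i I)
  then show ?case using power_add_eq_0 by (metis insertCI sum.insert)
qed (auto intro: exI[of _ 1])

text \<open>
  The Cauchy product for truncated series.  The right-hand side covers only the part \<open>i + j < N\<close> of
  the square; for products of powers of nilpotent elements the rest vanishes.
\<close>

lemma sum_square_eq_sum_triangle:
  fixes t :: "nat \<Rightarrow> nat \<Rightarrow> 'a::comm_monoid_add"
  assumes "\<And>i j. N \<le> i + j \<Longrightarrow> t i j = 0"
  shows "(\<Sum>i<N. \<Sum>j<N. t i j) = (\<Sum>k<N. \<Sum>i\<le>k. t i (k - i))"
proof -
  have "(\<Sum>i<N. \<Sum>j<N. t i j) = (\<Sum>(i,j)\<in>{..<N} \<times> {..<N}. t i j)"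
    by (simp add: sum.cartesian_product)
  also have "\<dots> = (\<Sum>(i,j)\<in>{(i,j). i + j < N}. t i j)"
    by (rule sum.mono_neutral_right) (auto, metis assms not_less)
  also have "\<dots> = (\<Sum>k<N. \<Sum>i\<le>k. t i (k - i))"
    by (rule sum.triangle_reindex)
  finally show ?thesis .
qed

context algebra_over
begin

lemma smul_mult_right: "a * smul c b = smul c (a * b)"
  by (metis mult.commute smul_mult)

lemma smul_mult_smul: "smul c a * smul d b = smul (c * d) (a * b)"
  by (metis smul_mult smul_mult_right scale_scale)

lemma smul_eq_mult: "smul c a = smul c 1 * a"
  using smul_mult[of c 1 a] by simp

lemma fps_eval_eq_sum:
  assumes "a ^ N = 0"
  shows "fps_eval smul F a = (\<Sum>k<N. smul (fps_nth F k) (a ^ k))"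
  unfolding fps_eval_def
proof (rule Sum_any.expand_superset)
  show "{k. smul (fps_nth F k) (a ^ k) \<noteq> 0} \<subseteq> {..<N}"
    using power_eq_0_mono[OF assms] by (auto simp flip: not_le)
qed simp

lemma fps_eval_mult:
  assumes "a ^ N = 0"
  shows "fps_eval smul (F * G) a = fps_eval smul F a * fps_eval smul G a"
proof -
  let ?t = "\<lambda>i j. smul (fps_nth F i * fps_nth G j) (a ^ (i + j))"
  have outside: "?t i j = 0" if "N \<le> i + j" for i j
    using power_eq_0_mono[OF assms, of "i + j"] that by simp
  have "fps_eval smul F a * fps_eval smul G a = (\<Sum>i<N. \<Sum>j<N. ?t i j)"
    by (simp add: fps_eval_eq_sum[OF assms] sum_product smul_mult_smul power_add)
  also have "\<dots> = (\<Sum>k<N. \<Sum>i\<le>k. ?t i (k - i))"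
    by (rule sum_square_eq_sum_triangle) (simp add: outside)
  also have "\<dots> = fps_eval smul (F * G) a"
    by (simp add: fps_eval_eq_sum[OF assms] fps_mult_nth scale_sum_left atMost_atLeast0)
  finally show ?thesis by simp
qed

lemma fps_eval_diff:
  assumes "a ^ N = 0"
  shows "fps_eval smul (F - G) a = fps_eval smul F a - fps_eval smul G a"
  by (simp add: fps_eval_eq_sum[OF assms] scale_left_diff_distrib sum_subtractf)

lemma fps_eval_1: "fps_eval smul 1 a = 1"
  unfolding fps_eval_def
  by (subst Sum_any.expand_superset[of "{0}"]) (auto simp: fps_one_nth)

lemma fps_eval_X: "fps_eval smul fps_X a = a"
  unfolding fps_eval_def
  by (subst Sum_any.expand_superset[of "{1}"]) (auto simp: fps_X_nth)

lemma fps_eval_power: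
  assumes "a ^ N = 0"
  shows "fps_eval smul (F ^ k) a = fps_eval smul F a ^ k"
  by (induction k) (simp_all add: fps_eval_1 fps_eval_mult[OF assms])

lemma fps_eval_nilpotent:
  assumes "a ^ N = 0" "fps_nth F 0 = 0"
  shows "fps_eval smul F a ^ N = 0"
proof -
  have "fps_eval smul F a ^ N = fps_eval smul (F ^ N) a"
    by (simp add: fps_eval_power[OF assms(1)])
  also have "\<dots> = 0"
    using startsby_zero_power_prefix[OF assms(2), of N] by (simp add: fps_eval_eq_sum[OF assms(1)])
  finally show ?thesis .
qed

text \<open>
  Since \<open>G\<close> has no constant term, \<open>G ^ i\<close> starts in degree \<open>i\<close>.  Hence below degree \<open>N\<close> the
  coefficients of \<open>F oo G\<close> involve only the powers with \<open>i < N\<close>, and both sides become the same finite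
  double sum.
\<close>

lemma fps_eval_compose:
  assumes "a ^ N = 0" "fps_nth G 0 = 0"
  shows "fps_eval smul (F oo G) a = fps_eval smul F (fps_eval smul G a)"
proof -
  have coeff: "fps_nth (F oo G) n = (\<Sum>i<N. fps_nth F i * fps_nth (G ^ i) n)" if "n < N" for n
    unfolding fps_compose_nth using that startsby_zero_power_prefix[OF assms(2)]
    by (intro sum.mono_neutral_left) auto
  have "fps_eval smul (F oo G) a
      = (\<Sum>n<N. \<Sum>i<N. smul (fps_nth F i * fps_nth (G ^ i) n) (a ^ n))"
    by (simp add: fps_eval_eq_sum[OF assms(1)] coeff scale_sum_left)
  also have "\<dots> = (\<Sum>i<N. \<Sum>n<N. smul (fps_nth F i * fps_nth (G ^ i) n) (a ^ n))"
    by (rule sum.swap)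
  also have "\<dots> = (\<Sum>i<N. smul (fps_nth F i) (fps_eval smul (G ^ i) a))"
    by (simp add: fps_eval_eq_sum[OF assms(1)] scale_sum_right)
  also have "\<dots> = fps_eval smul F (fps_eval smul G a)"
    by (simp add: fps_eval_eq_sum[OF fps_eval_nilpotent[OF assms]] fps_eval_power[OF assms(1)])
  finally show ?thesis .
qed

lemma fps_eval_in_ideal:
  assumes "a ^ N = 0" "ring_ideal J" "a \<in> J" "fps_nth F 0 = 0"
  shows "fps_eval smul F a \<in> J"
proof -
  interpret R: module "(*) :: 'a \<Rightarrow> 'a \<Rightarrow> 'a" by unfold_locales (simp_all add: algebra_simps)
  have J: "R.subspace J" using assms(2) by (simp add: ring_ideal_def)
  have "smul (fps_nth F k) (a ^ k) \<in> J" for k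
  proof (cases k)
    case 0
    then show ?thesis using assms(4) R.subspace_0[OF J] by simp
  next
    case (Suc l)
    have "smul (fps_nth F k) (a ^ k) = smul (fps_nth F k) (a ^ l) * a"
      by (metis Suc smul_mult power_Suc2)
    then show ?thesis using R.subspace_scale[OF J assms(3)] by simp
  qed
  then show ?thesis
    unfolding fps_eval_eq_sum[OF assms(1)] by (intro R.subspace_sum[OF J])
qed

text \<open>
  This is what turns an identity over a polynomial ring into identities at all points, with
  \<open>h\<close> the substitution of a point for the variables.
\<close>

lemma fps_eval_hom:
  assumes "a ^ N = 0"
    and add: "\<And>p q. h (p + q) = h p + h q"
    and mult: "\<And>p q. h (p * q) = h p * h q"
    and one: "h 1 = 1"
    and scale: "\<And>c p. h (smul c p) = smul' c (h p)"
    and "algebra_over smul'"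
  shows "h (fps_eval smul F a) = fps_eval smul' F (h a)"
proof -
  interpret B: algebra_over smul' by fact
  have zero: "h 0 = 0" using add[of 0 0] by simp
  have pow: "h (p ^ k) = h p ^ k" for p k by (induction k) (simp_all add: mult one)
  have sum: "h (sum g I) = (\<Sum>i\<in>I. h (g i))" for g :: "nat \<Rightarrow> 'a" and I
    by (induction I rule: infinite_finite_induct) (simp_all add: zero add)
  have "h a ^ N = 0" using assms(1) pow[of a N] zero by simp
  then show ?thesis
    by (simp add: fps_eval_eq_sum[OF assms(1)] B.fps_eval_eq_sum sum scale pow)
qed

end

locale algebra_char_0 = algebra_over smul
  for smul :: "'k::field_char_0 \<Rightarrow> 'a::comm_ring_1 \<Rightarrow> 'a"
begin

text \<open>
  The binomial theorem identifies the terms of total degree \<open>k\<close> of the product with those of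
  \<open>(a + b)^k / k!\<close>.
\<close>

lemma nilpotent_exp_add:
  assumes "a ^ m = 0" "b ^ n = 0"
  shows "nilpotent_exp smul (a + b) = nilpotent_exp smul a * nilpotent_exp smul b"
proof -
  define N where "N = m + n"
  have a: "a ^ N = 0" and b: "b ^ N = 0"
    using power_eq_0_mono[OF assms(1), of N] power_eq_0_mono[OF assms(2), of N] by (simp_all add: N_def)
  \<comment> \<open>With at least \<open>m + n\<close> factors in total, one of the two powers vanishes.\<close>
  have prod0: "a ^ i * b ^ j = 0" if "N \<le> i + j" for i j
  proof (cases "m \<le> i")
    case True
    then show ?thesis using power_eq_0_mono[OF assms(1)] by simp
  next
    case False
    then have "n \<le> j" using that by (simp add: N_def)
    then show ?thesis using power_eq_0_mono[OF assms(2)] by simp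
  qed
  let ?t = "\<lambda>i j. smul (inverse (fact i * fact j)) (a ^ i * b ^ j)"
  have "nilpotent_exp smul a * nilpotent_exp smul b = (\<Sum>i<N. \<Sum>j<N. ?t i j)"
    by (simp add: nilpotent_exp_eq_fps_eval fps_eval_eq_sum[OF a] fps_eval_eq_sum[OF b] sum_product
        smul_mult_smul field_simps)
  also have "\<dots> = (\<Sum>k<N. \<Sum>i\<le>k. ?t i (k - i))"
    by (rule sum_square_eq_sum_triangle) (simp add: prod0)
  also have "\<dots> = (\<Sum>k<N. smul (inverse (fact k)) ((a + b) ^ k))"
  proof (intro sum.cong refl)
    fix k
    have "?t i (k - i) = smul (inverse (fact k)) (of_nat (k choose i) * a ^ i * b ^ (k - i))"
      if "i \<le> k" for i
    proof -
      have "inverse (fact i * fact (k - i)) = inverse (fact k) * (of_nat (k choose i) :: 'k)"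
        using binomial_fact[OF that, where ?'a = 'k] by (simp add: field_simps)
      moreover have "smul (of_nat c) x = of_nat c * x" for c x
        by (induction c) (simp_all add: algebra_simps scale_left_distrib)
      ultimately show ?thesis by (simp add: mult.assoc flip: scale_scale)
    qed
    then show "(\<Sum>i\<le>k. ?t i (k - i)) = smul (inverse (fact k)) ((a + b) ^ k)"
      by (simp add: binomial_ring scale_sum_right)
  qed
  also have "\<dots> = nilpotent_exp smul (a + b)"
    using power_add_eq_0[OF assms]
    by (simp add: nilpotent_exp_eq_fps_eval fps_eval_eq_sum[where N = N] N_def field_simps)
  finally show ?thesis by simp
qed

end

section \<open>Polynomials with coefficients in an algebra\<close>

lemma lookup_tensor:
  assumes "\<And>a. smul 0 a = 0"
  shows "Poly_Mapping.lookup (tensor smul a p) m = smul (Poly_Mapping.lookup p m) a"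
  using assms by (simp add: tensor_def Poly_Mapping.map.rep_eq when_def)

lemma lookup_mpoly_scale:
  assumes "smul c 0 = 0"
  shows "Poly_Mapping.lookup (mpoly_scale smul c p) m = smul c (Poly_Mapping.lookup p m)"
  using assms by (simp add: mpoly_scale_def Poly_Mapping.map.rep_eq when_def)

lemma poly_mapping_sum_single:
  "p = (\<Sum>m\<in>Poly_Mapping.keys p. Poly_Mapping.single m (Poly_Mapping.lookup p m))"
  by (rule poly_mapping_eqI)
     (auto simp: lookup_sum lookup_single when_def in_keys_iff)

text \<open>Reduces identities that are additive in a polynomial to its monomials.\<close>

lemma additive_poly_mapping_eqI:
  fixes h g :: "('n \<Rightarrow>\<^sub>0 'a::comm_monoid_add) \<Rightarrow> 'b::comm_monoid_add"
  assumes "\<And>p q. h (p + q) = h p + h q" "\<And>p q. g (p + q) = g p + g q"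
    and "h 0 = 0" "g 0 = 0"
    and "\<And>m a. h (Poly_Mapping.single m a) = g (Poly_Mapping.single m a)"
  shows "h p = g p"
proof -
  have h: "h (sum u I) = (\<Sum>i\<in>I. h (u i))" for u :: "'n \<Rightarrow> _" and I
    by (induction I rule: infinite_finite_induct) (simp_all add: assms)
  have g: "g (sum u I) = (\<Sum>i\<in>I. g (u i))" for u :: "'n \<Rightarrow> _" and I
    by (induction I rule: infinite_finite_induct) (simp_all add: assms)
  show ?thesis by (subst (1 2) poly_mapping_sum_single) (simp only: h g assms(5))
qed

definition monomial_value :: "'k::comm_ring_1 ^ 'n::finite \<Rightarrow> ('n \<Rightarrow>\<^sub>0 nat) \<Rightarrow> 'k"
  where "monomial_value x m = (\<Prod>i\<in>UNIV. (x $ i) ^ Poly_Mapping.lookup m i)"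

lemma monomial_value_0: "monomial_value x 0 = 1"
  by (simp add: monomial_value_def)

lemma monomial_value_add: "monomial_value x (m + m') = monomial_value x m * monomial_value x m'"
  by (simp add: monomial_value_def lookup_add power_add prod.distrib)

text \<open>
  The coefficients lie in an algebra, the point has coordinates in its base field, so this is
  the base change to the algebra of the evaluation \<open>mpoly_eval\<close>.
\<close>

definition mpoly_eval_alg ::
  "('k::comm_ring_1 \<Rightarrow> 'a::comm_ring_1 \<Rightarrow> 'a) \<Rightarrow> 'k ^ 'n::finite \<Rightarrow> ('a, 'n) mpoly \<Rightarrow> 'a"
  where "mpoly_eval_alg smul x p =
    (\<Sum>m \<in> Poly_Mapping.keys p. smul (monomial_value x m) (Poly_Mapping.lookup p m))"

context algebra_over
begin

lemma algebra_over_mpoly: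
  "algebra_over (mpoly_scale smul :: 'k \<Rightarrow> ('a, 'n) mpoly \<Rightarrow> ('a, 'n) mpoly)"
proof
  fix c d and p q :: "('a, 'n) mpoly"
  note L = lookup_mpoly_scale[of smul, OF scale_zero_right]
  show "mpoly_scale smul c (p + q) = mpoly_scale smul c p + mpoly_scale smul c q"
    by (rule poly_mapping_eqI) (simp add: L lookup_add scale_right_distrib)
  show "mpoly_scale smul (c + d) p = mpoly_scale smul c p + mpoly_scale smul d p"
    by (rule poly_mapping_eqI) (simp add: L lookup_add scale_left_distrib)
  show "mpoly_scale smul c (mpoly_scale smul d p) = mpoly_scale smul (c * d) p"
    by (rule poly_mapping_eqI) (simp add: L)
  show "mpoly_scale smul 1 p = p"
    by (rule poly_mapping_eqI) (simp add: L)
  \<comment> \<open>Scaling is multiplication by a constant polynomial, so the last axiom is associativity.\<close>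
  have scale_eq: "mpoly_scale smul c r = Poly_Mapping.single 0 (smul c 1) * r" for r :: "('a, 'n) mpoly"
  proof (rule additive_poly_mapping_eqI[of "mpoly_scale smul c" "\<lambda>r. Poly_Mapping.single 0 (smul c 1) * r"])
    show "mpoly_scale smul c (u + v) = mpoly_scale smul c u + mpoly_scale smul c v"
      for u v :: "('a, 'n) mpoly"
      by (rule poly_mapping_eqI) (simp add: L lookup_add scale_right_distrib)
    show "mpoly_scale smul c 0 = (0 :: ('a, 'n) mpoly)"
      by (rule poly_mapping_eqI) (simp add: L)
    show "mpoly_scale smul c (Poly_Mapping.single m a) =
        Poly_Mapping.single 0 (smul c 1) * Poly_Mapping.single m a" for m :: "'n \<Rightarrow>\<^sub>0 nat" and a
      unfolding mult_single
      by (rule poly_mapping_eqI) (auto simp: L lookup_single when_def simp flip: smul_mult)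
  qed (simp_all add: distrib_left)
  show "mpoly_scale smul c (p * q) = mpoly_scale smul c p * q"
    by (simp add: scale_eq mult.assoc)
qed

lemma mpoly_eval_alg_superset:
  assumes "finite S" "Poly_Mapping.keys p \<subseteq> S"
  shows "mpoly_eval_alg smul x p = (\<Sum>m\<in>S. smul (monomial_value x m) (Poly_Mapping.lookup p m))"
  unfolding mpoly_eval_alg_def using assms
  by (intro sum.mono_neutral_left) (auto simp: in_keys_iff)

lemma mpoly_eval_alg_0: "mpoly_eval_alg smul x 0 = 0"
  by (simp add: mpoly_eval_alg_def)

lemma mpoly_eval_alg_add:
  "mpoly_eval_alg smul x (p + q) = mpoly_eval_alg smul x p + mpoly_eval_alg smul x q"
proof -
  let ?S = "Poly_Mapping.keys p \<union> Poly_Mapping.keys q"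
  show ?thesis
    by (simp add: mpoly_eval_alg_superset[of ?S] keys_add lookup_add scale_right_distrib sum.distrib)
qed

lemma mpoly_eval_alg_single:
  "mpoly_eval_alg smul x (Poly_Mapping.single m a) = smul (monomial_value x m) a"
  by (simp add: mpoly_eval_alg_superset[of "{m}"] lookup_single)

lemma mpoly_eval_alg_1: "mpoly_eval_alg smul x 1 = 1"
  unfolding single_one[symmetric] mpoly_eval_alg_single by (simp add: monomial_value_0)

lemma mpoly_eval_alg_sum: "mpoly_eval_alg smul x (sum g I) = (\<Sum>i\<in>I. mpoly_eval_alg smul x (g i))"
  by (induction I rule: infinite_finite_induct) (simp_all add: mpoly_eval_alg_0 mpoly_eval_alg_add)

lemma mpoly_eval_alg_mult:
  "mpoly_eval_alg smul x (p * q) = mpoly_eval_alg smul x p * mpoly_eval_alg smul x q"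
proof (rule additive_poly_mapping_eqI[of "\<lambda>p. mpoly_eval_alg smul x (p * q)"
      "\<lambda>p. mpoly_eval_alg smul x p * mpoly_eval_alg smul x q" p])
  fix m a
  show "mpoly_eval_alg smul x (Poly_Mapping.single m a * q) =
      mpoly_eval_alg smul x (Poly_Mapping.single m a) * mpoly_eval_alg smul x q"
    by (rule additive_poly_mapping_eqI[of "\<lambda>q. mpoly_eval_alg smul x (Poly_Mapping.single m a * q)"
        "\<lambda>q. mpoly_eval_alg smul x (Poly_Mapping.single m a) * mpoly_eval_alg smul x q" q])
       (simp_all add: distrib_left mpoly_eval_alg_add mpoly_eval_alg_0 mult_single
          mpoly_eval_alg_single smul_mult_smul monomial_value_add)
qed (simp_all add: distrib_right mpoly_eval_alg_add mpoly_eval_alg_0)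

lemma mpoly_eval_alg_scale: "mpoly_eval_alg smul x (mpoly_scale smul c p) = smul c (mpoly_eval_alg smul x p)"
proof -
  have "Poly_Mapping.keys (mpoly_scale smul c p) \<subseteq> Poly_Mapping.keys p"
    by (auto simp: in_keys_iff lookup_mpoly_scale)
  then show ?thesis
    by (simp add: mpoly_eval_alg_superset[of "Poly_Mapping.keys p"] lookup_mpoly_scale scale_sum_right
        mult.commute)
qed

lemma mpoly_eval_alg_tensor: "mpoly_eval_alg smul x (tensor smul a p) = smul (mpoly_eval p x) a"
proof -
  have "Poly_Mapping.keys (tensor smul a p) \<subseteq> Poly_Mapping.keys p"
    by (auto simp: in_keys_iff lookup_tensor)
  then show ?thesis
    by (simp add: mpoly_eval_alg_superset[of "Poly_Mapping.keys p"] lookup_tensor mpoly_eval_def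
        scale_sum_left monomial_value_def mult.commute)
qed

lemma mpoly_eval_var: "mpoly_eval (mpoly_var i) x = x $ i"
proof -
  have "(\<Prod>j\<in>UNIV. x $ j ^ Poly_Mapping.lookup (Poly_Mapping.single i (1::nat)) j)
      = (\<Prod>j\<in>UNIV. if j = i then x $ j else 1)"
    by (intro prod.cong) (auto simp: lookup_single when_def)
  then show ?thesis by (simp add: mpoly_eval_def mpoly_var_def)
qed

end

section \<open>Polynomial maps and translations on the chart\<close>

lemma chart_map_affine_pt_poly_map: "chart_map f (affine_pt x) = affine_pt (poly_map f x)"
  by (simp add: chart_map_affine_pt poly_map_def)

lemma chart_map_in_Aut_U:
  assumes gf: "\<And>x. poly_map g (poly_map f x) = x" and fg: "\<And>x. poly_map f (poly_map g x) = x"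
  shows "chart_map f \<in> Aut_U"
proof -
  have bij: "bij_betw (chart_map f) chart_U chart_U"
    by (rule bij_betw_byWitness[where f' = "chart_map g"])
       (auto simp: chart_U_eq_range chart_map_affine_pt_poly_map gf fg)
  have "inv_into chart_U (chart_map f) p = chart_map g p" if "p \<in> chart_U" for p
  proof (rule inv_into_f_eq)
    show "inj_on (chart_map f) chart_U" using bij by (rule bij_betw_imp_inj_on)
  qed (use that in \<open>auto simp: chart_U_eq_range chart_map_affine_pt_poly_map fg\<close>)
  then show ?thesis using bij by (auto simp: Aut_U_def regular_on_U_def)
qed

text \<open>A representative \<open>w\<close> of the translated point comes from the multiple of \<open>(1, x)\<close> by \<open>w\<^sub>0\<close>.\<close>

lemma standard_action_affine_pt: "standard_action y (affine_pt x) = affine_pt (x + y)"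
proof (intro set_eqI iffI)
  fix w assume "w \<in> standard_action y (affine_pt x)"
  then show "w \<in> affine_pt (x + y)"
    by (auto simp: standard_action_def mem_affine_pt algebra_simps)
next
  fix w assume w: "w \<in> affine_pt (x + y)"
  let ?z = "(\<chi> j. case j of None \<Rightarrow> w $ None | Some i \<Rightarrow> w $ None * x $ i) :: 'a ^ 'b option"
  have "w = (\<chi> j. case j of None \<Rightarrow> ?z $ None | Some i \<Rightarrow> ?z $ Some i + y $ i * ?z $ None)"
    using w by (auto simp: vec_eq_iff mem_affine_pt algebra_simps split: option.split)
  moreover have "?z \<in> affine_pt x" using w by (simp add: mem_affine_pt)
  ultimately show "w \<in> standard_action y (affine_pt x)"
    unfolding standard_action_def by (rule image_eqI)
qed

section \<open>Finite-dimensional local algebras\<close>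

lemma ring_ideal_iff:
  "ring_ideal I \<longleftrightarrow> 0 \<in> I \<and> (\<forall>x\<in>I. \<forall>y\<in>I. x + y \<in> I) \<and> (\<forall>c. \<forall>x\<in>I. c * x \<in> I)"
proof -
  interpret R: module "(*) :: 'a \<Rightarrow> 'a \<Rightarrow> 'a" by unfold_locales (simp_all add: algebra_simps)
  show ?thesis by (auto simp: ring_ideal_def R.subspace_def)
qed

lemma ring_ideal_sum:
  assumes "ring_ideal I" "\<And>i. i \<in> S \<Longrightarrow> g i \<in> I"
  shows "sum g S \<in> I"
  using assms(2)
  by (induction S rule: infinite_finite_induct) (use assms(1) in \<open>auto simp: ring_ideal_iff\<close>)

lemma ring_ideal_range_mult: "ring_ideal (range ((*) a))"
proof -
  have "0 \<in> range ((*) a)" by (rule range_eqI[of _ _ 0]) simp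
  moreover have "a * x + a * y \<in> range ((*) a)" for x y
    by (rule range_eqI[of _ _ "x + y"]) (simp add: distrib_left)
  moreover have "c * (a * x) \<in> range ((*) a)" for c x
    by (rule range_eqI[of _ _ "c * x"]) (simp add: mult.left_commute)
  ultimately show ?thesis by (auto simp: ring_ideal_iff)
qed

lemma local_ring_ideal:
  assumes "local_ring_with M"
  shows "ring_ideal M" "1 \<notin> M"
proof -
  have M: "maximal_ideal M" using assms by (auto simp: local_ring_with_def)
  then show ideal: "ring_ideal M" by (simp add: maximal_ideal_def)
  show "1 \<notin> M"
  proof
    assume "1 \<in> M"
    then have "x \<in> M" for x using ideal by (metis mult.right_neutral ring_ideal_iff)
    then show False using M by (auto simp: maximal_ideal_def)
  qed
qed

context algebra_over
begin

lemma subspace_ring_ideal: "ring_ideal I \<Longrightarrow> subspace I"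
  by (metis ring_ideal_iff smul_eq_mult subspace_def)

lemma finite_dimensional_if_dim_pos:
  assumes "dim UNIV > 0"
  obtains B where "finite_dimensional_vector_space smul B"
proof -
  obtain B where "independent B" "UNIV \<subseteq> span B" "card B = dim UNIV"
    using basis_exists[of UNIV] by metis
  then have "finite_dimensional_vector_space smul B"
    using assms by unfold_locales (auto intro: card_ge_0_finite)
  then show ?thesis by (rule that)
qed

text \<open>
  Ideals are linear subspaces, so a proper ideal of largest dimension among those that contain
  \<open>I\<close> is maximal.
\<close>

lemma proper_ideal_subset_maximal:
  fixes I :: "'a set"
  assumes "dim UNIV > 0" "ring_ideal I" "1 \<notin> I"
  obtains J where "maximal_ideal J" "I \<subseteq> J"
proof -
  obtain B where "finite_dimensional_vector_space smul B"
    using finite_dimensional_if_dim_pos[OF assms(1)] .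
  then interpret finite_dimensional_vector_space smul B .
  let ?P = "\<lambda>J. ring_ideal J \<and> 1 \<notin> J \<and> I \<subseteq> J"
  have "\<forall>J. ?P J \<longrightarrow> dim J < Suc (dim UNIV)"
    by (intro allI impI le_imp_less_Suc dim_subset subset_UNIV)
  moreover have "?P I" using assms(2,3) by simp
  ultimately have "\<exists>J. ?P J \<and> (\<forall>J'. ?P J' \<longrightarrow> dim J' \<le> dim J)"
    by (intro ex_has_greatest_nat)
  then obtain J where J: "?P J" and max: "\<And>J'. ?P J' \<Longrightarrow> dim J' \<le> dim J"
    by (elim exE conjE) simp
  have "J' = J \<or> J' = UNIV" if J': "ring_ideal J'" "J \<subseteq> J'" for J'
  proof (cases "1 \<in> J'")
    case True
    then have "x \<in> J'" for x using J'(1) by (metis mult.right_neutral ring_ideal_iff)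
    then show ?thesis by auto
  next
    case False
    then have "dim J' \<le> dim J" using max J J' by blast
    then have "J = J'"
      using subspace_dim_equal[of J J'] subspace_ring_ideal J J' by blast
    then show ?thesis by simp
  qed
  then have "maximal_ideal J" using J by (auto simp: maximal_ideal_def)
  then show ?thesis using that J by blast
qed

lemma unit_if_notin_local:
  fixes M :: "'a set"
  assumes "dim UNIV > 0" "local_ring_with M" "a \<notin> M"
  obtains b where "a * b = 1"
proof (cases "1 \<in> range ((*) a)")
  case True
  then obtain b where "1 = a * b" by auto
  then show ?thesis using that by simp
next
  case False
  then obtain J where "maximal_ideal J" "range ((*) a) \<subseteq> J"
    using proper_ideal_subset_maximal[OF assms(1) ring_ideal_range_mult] by metis
  then have "range ((*) a) \<subseteq> M" using assms(2) by (auto simp: local_ring_with_def)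
  then have "a * 1 \<in> M" by blast
  then show ?thesis using assms(3) by simp
qed

text \<open>
  The ideals generated by the powers of \<open>a\<close> descend, so by dimension they become stationary:
  \<open>a^k = a^(k+1) b\<close> for some \<open>k\<close> and \<open>b\<close>.  Then \<open>a^k (1 - a b) = 0\<close>, where the second factor is a
  unit because it lies outside \<open>M\<close>.
\<close>

lemma nilpotent_if_in_local:
  fixes M :: "'a set"
  assumes "dim UNIV > 0" "local_ring_with M" "a \<in> M"
  shows "\<exists>N. a ^ N = 0"
proof -
  obtain B where "finite_dimensional_vector_space smul B"
    using finite_dimensional_if_dim_pos[OF assms(1)] .
  then interpret finite_dimensional_vector_space smul B .
  note M = local_ring_ideal[OF assms(2)]
  let ?I = "\<lambda>k. range ((*) (a ^ k))"
  obtain k where k: "\<And>l. dim (?I k) \<le> dim (?I l)"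
    using ex_has_least_nat[of "\<lambda>_. True" 0 "\<lambda>k. dim (?I k)"] by auto
  have "?I (Suc k) = ?I k"
  proof (rule subspace_dim_equal)
    show "?I (Suc k) \<subseteq> ?I k"
      using ring_ideal_range_mult[of "a ^ k"] by (auto simp: ring_ideal_iff mult.assoc)
    show "dim (?I k) \<le> dim (?I (Suc k))" by (rule k)
  qed (intro subspace_ring_ideal ring_ideal_range_mult)+
  then obtain b where "a ^ k * 1 = a ^ Suc k * b" by blast
  then have zero: "a ^ k * (1 - a * b) = 0" by (simp add: algebra_simps)
  have "1 - a * b \<notin> M"
  proof
    assume "1 - a * b \<in> M"
    moreover have "b * a \<in> M" using M(1) assms(3) by (simp add: ring_ideal_iff)
    ultimately have "(1 - a * b) + b * a \<in> M" using M(1) unfolding ring_ideal_iff by blast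
    then show False using M(2) by (simp add: mult.commute)
  qed
  then obtain c where "(1 - a * b) * c = 1"
    by (rule unit_if_notin_local[OF assms(1,2)])
  then have "a ^ k = a ^ k * (1 - a * b) * c" by (simp add: mult.assoc)
  then show ?thesis using zero by auto
qed

end

section \<open>The basic polynomials\<close>

text \<open>
  The facts about a finite-dimensional local algebra and a basis of its maximal ideal that
  the exponential correspondence uses.
\<close>

locale local_algebra = algebra_char_0 smul
  for smul :: "'k::field_char_0 \<Rightarrow> 'a::comm_ring_1 \<Rightarrow> 'a" +
  fixes s :: "'n::finite \<Rightarrow> 'a" and M :: "'a set"
  assumes ideal: "ring_ideal M"
    and one_notin: "1 \<notin> M"
    and nilpotent: "a \<in> M \<Longrightarrow> \<exists>N. a ^ N = 0"
    and basis: "indexed_basis smul s M"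
begin

definition lin :: "'k ^ 'n \<Rightarrow> 'a"
  where "lin x = (\<Sum>i\<in>UNIV. smul (x $ i) (s i))"

definition generic_elem :: "('a, 'n) mpoly"
  where "generic_elem = (\<Sum>i\<in>UNIV. tensor smul (s i) (mpoly_var i))"

lemma in_span_basis: "a \<in> M \<longleftrightarrow> a \<in> span (range s)"
  using basis by (simp add: indexed_basis_def)

lemma s_in: "s i \<in> M"
  by (simp add: in_span_basis span_base)

lemma lin_in: "lin x \<in> M"
  unfolding lin_def in_span_basis by (intro span_sum span_scale span_base) simp

lemma lin_add: "lin (x + y) = lin x + lin y"
  by (simp add: lin_def scale_left_distrib sum.distrib)

lemma coordinates_unique:
  assumes "(\<Sum>i\<in>UNIV. smul (c i) (s i)) = (\<Sum>i\<in>UNIV. smul (d i) (s i))"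
  shows "c = d"
proof
  fix i
  have inj: "inj s" and indep: "independent (range s)"
    using basis by (simp_all add: indexed_basis_def)
  let ?u = "\<lambda>v. c (inv s v) - d (inv s v)"
  have "(\<Sum>v\<in>range s. smul (?u v) v) = 0"
    using assms inj by (simp add: sum.reindex scale_left_diff_distrib sum_subtractf)
  then have "?u (s i) = 0"
    using independentD[OF indep, of "range s" ?u "s i"] by simp
  then show "c i = d i" using inj by simp
qed

lemma lin_inj: "lin x = lin y \<Longrightarrow> x = y"
  using coordinates_unique[of "\<lambda>i. x $ i" "\<lambda>i. y $ i"] by (simp add: lin_def vec_eq_iff fun_eq_iff)

text \<open>
  In other words \<open>1, s\<^sub>1, \<dots>, s\<^sub>n\<close> are linearly independent: the proper subspace \<open>M\<close> contains
  no nonzero multiple of \<open>1\<close>.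
\<close>

lemma scalar_plus_lin_inj:
  assumes "smul a 1 + lin x = smul b 1 + lin y"
  shows "a = b \<and> x = y"
proof -
  have M: "subspace M" by (rule subspace_ring_ideal[OF ideal])
  have "smul (a - b) 1 = lin y - lin x"
    using assms by (simp add: scale_left_diff_distrib algebra_simps)
  then have "smul (a - b) 1 \<in> M" using subspace_diff[OF M lin_in lin_in] by simp
  then have "smul (inverse (a - b)) (smul (a - b) 1) \<in> M" by (rule subspace_scale[OF M])
  then have "a = b" using one_notin by (cases "a = b") simp_all
  then show ?thesis using assms lin_inj by simp
qed

lemma ring_ideal_coefficients: "ring_ideal {p :: ('a, 'n) mpoly. \<forall>m. Poly_Mapping.lookup p m \<in> M}"
proof -
  have "Poly_Mapping.lookup (q * p) m \<in> M"
    if "\<forall>m. Poly_Mapping.lookup p m \<in> M" for p q :: "('a, 'n) mpoly" and m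
  proof -
    have "(Poly_Mapping.lookup p r when m = l + r) \<in> M" for l r
      using that ideal by (simp add: when_def ring_ideal_iff)
    then have "(\<Sum>r. Poly_Mapping.lookup p r when m = l + r) \<in> M" for l
      unfolding Sum_any.expand_set by (intro ring_ideal_sum[OF ideal])
    then have "Poly_Mapping.lookup q l * (\<Sum>r. Poly_Mapping.lookup p r when m = l + r) \<in> M" for l
      using ideal by (simp add: ring_ideal_iff)
    then show ?thesis
      unfolding lookup_mult Sum_any.expand_set[of "\<lambda>l. Poly_Mapping.lookup q l * _ l"]
      by (intro ring_ideal_sum[OF ideal])
  qed
  then show ?thesis
    using ideal by (auto simp: ring_ideal_iff lookup_add)
qed

text \<open>
  The coordinates of the coefficients of \<open>p\<close> in the basis \<open>s\<close> are the coefficients of the \<open>f\<^sub>i\<close>.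
\<close>

lemma poly_of_coefficients_in_ideal:
  assumes "\<And>m. Poly_Mapping.lookup p m \<in> M"
  obtains f :: "'n \<Rightarrow> ('k, 'n) mpoly" where "p = (\<Sum>i\<in>UNIV. tensor smul (s i) (f i))"
proof -
  have inj: "inj s" and indep: "independent (range s)"
    using basis by (simp_all add: indexed_basis_def)
  define f where "f i = Poly_Mapping.map (\<lambda>a. representation (range s) a (s i)) p" for i
  have coeff: "Poly_Mapping.lookup (f i) m = representation (range s) (Poly_Mapping.lookup p m) (s i)"
    for i m
    by (simp add: f_def Poly_Mapping.map.rep_eq when_def representation_zero)
  have "p = (\<Sum>i\<in>UNIV. tensor smul (s i) (f i))"
  proof (rule poly_mapping_eqI)
    fix m
    have "Poly_Mapping.lookup p m \<in> span (range s)" using assms by (simp add: in_span_basis)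
    then have "(\<Sum>v\<in>range s. smul (representation (range s) (Poly_Mapping.lookup p m) v) v)
        = Poly_Mapping.lookup p m"
      by (intro sum_representation_eq[OF indep]) simp_all
    then show "Poly_Mapping.lookup p m
        = Poly_Mapping.lookup (\<Sum>i\<in>UNIV. tensor smul (s i) (f i)) m"
      using inj by (simp add: lookup_sum lookup_tensor coeff sum.reindex)
  qed
  then show ?thesis by (rule that)
qed

lemma tensor_sum_unique:
  fixes f g :: "'n \<Rightarrow> ('k, 'n) mpoly"
  assumes "(\<Sum>i\<in>UNIV. tensor smul (s i) (f i)) = (\<Sum>i\<in>UNIV. tensor smul (s i) (g i))"
  shows "f = g"
proof
  fix i
  have "(\<lambda>i. Poly_Mapping.lookup (f i) m) = (\<lambda>i. Poly_Mapping.lookup (g i) m)" for m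
    using arg_cong[OF assms, of "\<lambda>p. Poly_Mapping.lookup p m"]
    by (intro coordinates_unique) (simp add: lookup_sum lookup_tensor)
  then show "f i = g i" by (intro poly_mapping_eqI) (metis (no_types))
qed

lemma tensor_var: "tensor smul a (mpoly_var i) = Poly_Mapping.single (Poly_Mapping.single i 1) a"
  by (rule poly_mapping_eqI) (simp add: lookup_tensor mpoly_var_def lookup_single when_def)

text \<open>A power of a monomial \<open>s\<^sub>i x\<^sub>i\<close> has the same power of \<open>s\<^sub>i\<close> as coefficient.\<close>

lemma generic_elem_nilpotent: "\<exists>N. generic_elem ^ N = 0"
  unfolding generic_elem_def
proof (rule sum_nilpotent)
  fix i
  have pow: "\<exists>m'. Poly_Mapping.single m a ^ N = Poly_Mapping.single m' (a ^ N)"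
    for m :: "'n \<Rightarrow>\<^sub>0 nat" and a :: 'a and N
  proof (induction N)
    case 0
    then show ?case by (metis power_0 single_one)
  next
    case (Suc N)
    then show ?case by (metis mult_single power_Suc)
  qed
  obtain N where "s i ^ N = 0" using nilpotent[OF s_in] by metis
  then show "\<exists>N. tensor smul (s i) (mpoly_var i) ^ N = (0 :: ('a, 'n) mpoly)"
    using pow[of _ "s i" N] unfolding tensor_var by (metis single_zero)
qed

lemma generic_elem_coefficients: "Poly_Mapping.lookup generic_elem m \<in> M"
  unfolding generic_elem_def lookup_sum tensor_var lookup_single using ideal s_in
  by (intro ring_ideal_sum[OF ideal]) (auto simp: when_def ring_ideal_iff)

text \<open>
  The source of all polynomials in the proof: \<open>F = exp X - 1\<close> gives the basic polynomials, and
  the compositional inverse of this series gives the inverse automorphism.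
\<close>

lemma fps_eval_generic_elem:
  assumes "fps_nth F 0 = 0"
  obtains f :: "'n \<Rightarrow> ('k, 'n) mpoly"
  where "fps_eval (mpoly_scale smul) F generic_elem = (\<Sum>i\<in>UNIV. tensor smul (s i) (f i))"
proof -
  interpret P: algebra_over "mpoly_scale smul :: 'k \<Rightarrow> ('a, 'n) mpoly \<Rightarrow> ('a, 'n) mpoly"
    by (rule algebra_over_mpoly)
  obtain N where "generic_elem ^ N = 0" using generic_elem_nilpotent by metis
  from P.fps_eval_in_ideal[OF this ring_ideal_coefficients _ assms]
  have "Poly_Mapping.lookup (fps_eval (mpoly_scale smul) F generic_elem) m \<in> M" for m
    using generic_elem_coefficients by simp
  then show ?thesis using poly_of_coefficients_in_ideal that by metis
qed

text \<open>Substituting \<open>x\<close> for the variables sends the generic element to \<open>lin x\<close>.\<close>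

lemma fps_eval_lin:
  assumes "fps_eval (mpoly_scale smul) F generic_elem = (\<Sum>i\<in>UNIV. tensor smul (s i) (f i))"
  shows "fps_eval smul F (lin x) = lin (poly_map f x)"
proof -
  interpret P: algebra_over "mpoly_scale smul :: 'k \<Rightarrow> ('a, 'n) mpoly \<Rightarrow> ('a, 'n) mpoly"
    by (rule algebra_over_mpoly)
  let ?h = "mpoly_eval_alg smul x"
  obtain N where "generic_elem ^ N = 0" using generic_elem_nilpotent by metis
  then have "?h (fps_eval (mpoly_scale smul) F generic_elem) = fps_eval smul F (?h generic_elem)"
    by (rule P.fps_eval_hom)
       (simp_all add: mpoly_eval_alg_add mpoly_eval_alg_mult mpoly_eval_alg_1 mpoly_eval_alg_scale
          algebra_over_axioms)
  moreover have "?h generic_elem = lin x"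
    by (simp add: generic_elem_def lin_def mpoly_eval_alg_sum mpoly_eval_alg_tensor mpoly_eval_var)
  moreover have "?h (\<Sum>i\<in>UNIV. tensor smul (s i) (f i)) = lin (poly_map f x)"
    by (simp add: lin_def poly_map_def mpoly_eval_alg_sum mpoly_eval_alg_tensor)
  ultimately show ?thesis using assms by simp
qed

lemma nilpotent_exp_eq:
  assumes "algebra_over smul'" "a ^ N = 0"
  shows "nilpotent_exp smul' a = 1 + fps_eval smul' (fps_exp (1::'k) - 1) a"
proof -
  interpret B: algebra_over smul' by fact
  show ?thesis
    by (simp add: nilpotent_exp_eq_fps_eval B.fps_eval_diff[OF assms(2)] B.fps_eval_1)
qed

lemma is_basic_polys_iff:
  "is_basic_polys smul s f \<longleftrightarrow> fps_eval (mpoly_scale smul) (fps_exp 1 - 1) generic_elem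
    = (\<Sum>i\<in>UNIV. tensor smul (s i) (f i))"
proof -
  obtain N where "generic_elem ^ N = 0" using generic_elem_nilpotent by metis
  from nilpotent_exp_eq[OF algebra_over_mpoly this] show ?thesis
    by (simp add: is_basic_polys_def flip: generic_elem_def)
qed

lemma is_basic_polys_basic_polys: "is_basic_polys smul s (basic_polys smul s)"
proof -
  obtain f where "fps_eval (mpoly_scale smul) (fps_exp 1 - 1) generic_elem
      = (\<Sum>i\<in>UNIV. tensor smul (s i) (f i))"
    by (rule fps_eval_generic_elem[of "fps_exp 1 - 1"]) simp_all
  then have "is_basic_polys smul s f" by (simp add: is_basic_polys_iff)
  moreover have "f' = f" if "is_basic_polys smul s f'" for f'
    using that \<open>is_basic_polys smul s f\<close> tensor_sum_unique by (simp add: is_basic_polys_iff)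
  ultimately show ?thesis unfolding basic_polys_def by (rule theI)
qed

lemma fps_eval_exp_lin:
  "fps_eval smul (fps_exp 1 - 1) (lin x) = lin (poly_map (basic_polys smul s) x)"
  using is_basic_polys_basic_polys by (intro fps_eval_lin) (simp add: is_basic_polys_iff)

lemma nilpotent_exp_lin: "nilpotent_exp smul (lin x) = 1 + lin (poly_map (basic_polys smul s) x)"
  using nilpotent[OF lin_in] nilpotent_exp_eq[OF algebra_over_axioms] fps_eval_exp_lin by metis

text \<open>
  The family \<open>g\<close> consists of the coordinates of \<open>log (1 + u)\<close>, as \<open>fps_inv (fps_exp 1 - 1)\<close> is
  the series of \<open>log (1 + X)\<close>.
\<close>

lemma basic_polys_inverse:
  obtains g where "\<forall>x. poly_map g (poly_map (basic_polys smul s) x) = x"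
    and "\<forall>x. poly_map (basic_polys smul s) (poly_map g x) = x"
proof -
  let ?E = "fps_exp (1::'k) - 1"
  have E0: "fps_nth ?E 0 = 0" and L0: "fps_nth (fps_inv ?E) 0 = 0"
    by (simp_all add: fps_inv_def)
  obtain g where "fps_eval (mpoly_scale smul) (fps_inv ?E) generic_elem
      = (\<Sum>i\<in>UNIV. tensor smul (s i) (g i))"
    using fps_eval_generic_elem[OF L0] .
  then have log: "fps_eval smul (fps_inv ?E) (lin x) = lin (poly_map g x)" for x
    by (rule fps_eval_lin)
  show ?thesis
  proof (rule that; intro allI)
    fix x
    obtain N where N: "lin x ^ N = 0" using nilpotent[OF lin_in] by metis
    have "lin (poly_map g (poly_map (basic_polys smul s) x)) = lin x"
      using fps_eval_compose[OF N E0, of "fps_inv ?E"]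
      by (simp add: fps_inv_fps_exp_compose fps_eval_X fps_eval_exp_lin log)
    then show "poly_map g (poly_map (basic_polys smul s) x) = x" by (rule lin_inj)
    have "lin (poly_map (basic_polys smul s) (poly_map g x)) = lin x"
      using fps_eval_compose[OF N L0, of ?E]
      by (simp add: fps_inv_fps_exp_compose fps_eval_X fps_eval_exp_lin log)
    then show "poly_map (basic_polys smul s) (poly_map g x) = x" by (rule lin_inj)
  qed
qed

text \<open>The functional equation of the exponential, written in coordinates.\<close>

lemma basic_polys_add:
  "1 + lin (poly_map (basic_polys smul s) (x + y)) =
    nilpotent_exp smul (lin y) * (1 + lin (poly_map (basic_polys smul s) x))"
proof -
  obtain m n where "lin x ^ m = 0" "lin y ^ n = 0" using nilpotent[OF lin_in] by metis
  then show ?thesis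
    by (simp add: nilpotent_exp_add lin_add mult.commute flip: nilpotent_exp_lin)
qed

section \<open>The two actions on the chart\<close>

lemma alg_elem_image_affine_pt:
  "alg_elem smul s ` affine_pt x = {smul c (1 + lin x) | c. c \<noteq> 0}"
proof -
  have elem: "alg_elem smul s z = smul (z $ None) (1 + lin x)" if "z \<in> affine_pt x" for z
    using that
    by (simp add: mem_affine_pt alg_elem_def lin_def scale_right_distrib scale_sum_right)
  have "smul c (1 + lin x) \<in> alg_elem smul s ` affine_pt x" if "c \<noteq> 0" for c
  proof
    let ?z = "(\<chi> j. case j of None \<Rightarrow> c | Some i \<Rightarrow> c * x $ i) :: 'k ^ 'n option"
    show z: "?z \<in> affine_pt x" using that by (simp add: mem_affine_pt)
    show "smul c (1 + lin x) = alg_elem smul s ?z" using elem[OF z] by simp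
  qed
  then show ?thesis using elem by (auto simp: mem_affine_pt)
qed

text \<open>\<open>alg_elem\<close> is injective, so the preimage of an image is the original set.\<close>

lemma alg_elem_vimage_class:
  "alg_elem smul s -` {smul c (1 + lin x) | c. c \<noteq> 0} = affine_pt x"
proof -
  have inj: "z = w" if "alg_elem smul s z = alg_elem smul s w" for z w :: "'k ^ 'n option"
  proof -
    have "alg_elem smul s u = smul (u $ None) 1 + lin (\<chi> i. u $ Some i)" for u :: "'k ^ 'n option"
      by (simp add: alg_elem_def lin_def)
    then have "z $ None = w $ None \<and> (\<chi> i. z $ Some i) = (\<chi> i. w $ Some i)"
      using scalar_plus_lin_inj that by metis
    then have "z $ j = w $ j" for j by (cases j) (simp_all add: vec_eq_iff)
    then show ?thesis by (simp add: vec_eq_iff)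
  qed
  show ?thesis unfolding alg_elem_image_affine_pt[symmetric] using inj by auto
qed

lemma algebra_action_affine_pt:
  assumes "1 + lin w = nilpotent_exp smul (lin y) * (1 + lin x)"
  shows "algebra_action smul s y (affine_pt x) = affine_pt w"
proof -
  have "(*) (nilpotent_exp smul (lin y)) ` {smul c (1 + lin x) | c. c \<noteq> 0}
      = {smul c (1 + lin w) | c. c \<noteq> 0}"
    unfolding setcompr_eq_image image_image assms by (simp only: smul_mult_right)
  then show ?thesis
    unfolding algebra_action_def lin_def[symmetric] alg_elem_image_affine_pt
    by (simp only: alg_elem_vimage_class)
qed

lemma chart_map_standard_action:
  "chart_map (basic_polys smul s) (standard_action y (affine_pt x)) =
    algebra_action smul s y (chart_map (basic_polys smul s) (affine_pt x))"
  by (simp add: standard_action_affine_pt chart_map_affine_pt_poly_map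
      algebra_action_affine_pt[OF basic_polys_add])

end

theorem theorem1:
  fixes smul :: "'k::{alg_closed_field, field_char_0} \<Rightarrow> 'a::comm_ring_1 \<Rightarrow> 'a"
    and s :: "'n::finite \<Rightarrow> 'a"
    and M :: "'a set"
  assumes "algebra_over smul"
    and "local_ring_with M"
    and "vector_space.dim smul (UNIV :: 'a set) = CARD('n) + 1"
    and "indexed_basis smul s M"
  shows "chart_map (basic_polys smul s) \<in> Aut_U \<and>
    (\<forall>y. \<forall>p\<in>chart_U. chart_map (basic_polys smul s) (standard_action y p) =
      algebra_action smul s y (chart_map (basic_polys smul s) p))"
proof -
  interpret algebra_over smul by fact
  have dim: "dim UNIV > 0" using assms(3) by simp
  interpret local_algebra smul s M
    using local_ring_ideal[OF assms(2)] nilpotent_if_in_local[OF dim assms(2)] assms(4)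
    by unfold_locales auto
  obtain g where "\<forall>x. poly_map g (poly_map (basic_polys smul s) x) = x"
    and "\<forall>x. poly_map (basic_polys smul s) (poly_map g x) = x"
    by (rule basic_polys_inverse)
  then have "chart_map (basic_polys smul s) \<in> Aut_U" by (intro chart_map_in_Aut_U[of g]) simp_all
  then show ?thesis using chart_map_standard_action by (auto simp: chart_U_eq_range)
qed

end
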